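(* Let $\mathbb{F}$ be a field of arbitrary characteristic. Let $f_1,f_2\in\mathbb{F}\langle X\rangle$ be non-zero polynomials of low degrees $d_1>0$ and $d_2>0$, respectively. Then there exist an associative $\mathbb{F}$-algebra $R$ and subalgebras $R_1,R_2$ of $R$ with $R=R_1+R_2$ such that: (1) for $i=1,2$, $R_i$ satisfies the identity $f_i$, and $R_i$ does not satisfy any identity of low degree less than $d_i$; (2) $R_2$ is a two-sided ideal of $R$; (3) $R$ does not satisfy any identity of degree less than $d_1d_2$.
   Context: Algebras are associative and need not have a unity. $R=R_1+R_2$ means that every element of $R$ is of the form $r_1+r_2$ with $r_1\in R_1$, $r_2\in R_2$. Let $\mathbb{F}\langle X\rangle$ be the free associative $\mathbb{F}$-algebra without unity on $x_1,x_2,\ldots$, i.e. the vector space with basis all non-empty words (monomials) in $x_1,x_2,\ldots$. An algebra $A$ satisfies the identity $f(x_1,\ldots,x_n)$, where $f\in\mathbb{F}\langle X\rangle$ is non-zero, if $f(a_1,\ldots,a_n)=0$ for all $a_1,\ldots,a_n\in A$. Write $f=\sum_i\alpha_iw_i$ with distinct monomials $w_i$ and non-zero $\alpha_i\in\mathbb{F}$. The degree of $f$ is the maximal degree (word length) of the $w_i$, and the low degree of $f$ is the minimal degree of the $w_i$; it is always positive. *)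

theory Defs
  imports "HOL-Algebra.Module" "HOL-Algebra.AbelCoset"
begin

text \<open>
  The library's \<^locale>\<open>algebra\<close> is commutative and unital, and all its ring locales have a unity.
  The locale below is built on the same record type \<^typ>\<open>('a, 'b) module\<close>; the field
  \<^const>\<open>one\<close> of that record is never referred to, and need not be a unity or lie in the carrier.
\<close>

locale nu_algebra = field F + module F A for F (structure) and A (structure) +
  assumes mult_closed: "\<lbrakk>x \<in> carrier A; y \<in> carrier A\<rbrakk> \<Longrightarrow> x \<otimes>\<^bsub>A\<^esub> y \<in> carrier A"
    and mult_assoc: "\<lbrakk>x \<in> carrier A; y \<in> carrier A; z \<in> carrier A\<rbrakk> \<Longrightarrow>
      (x \<otimes>\<^bsub>A\<^esub> y) \<otimes>\<^bsub>A\<^esub> z = x \<otimes>\<^bsub>A\<^esub> (y \<otimes>\<^bsub>A\<^esub> z)"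
    and distr_left: "\<lbrakk>x \<in> carrier A; y \<in> carrier A; z \<in> carrier A\<rbrakk> \<Longrightarrow>
      (x \<oplus>\<^bsub>A\<^esub> y) \<otimes>\<^bsub>A\<^esub> z = (x \<otimes>\<^bsub>A\<^esub> z) \<oplus>\<^bsub>A\<^esub> (y \<otimes>\<^bsub>A\<^esub> z)"
    and distr_right: "\<lbrakk>x \<in> carrier A; y \<in> carrier A; z \<in> carrier A\<rbrakk> \<Longrightarrow>
      z \<otimes>\<^bsub>A\<^esub> (x \<oplus>\<^bsub>A\<^esub> y) = (z \<otimes>\<^bsub>A\<^esub> x) \<oplus>\<^bsub>A\<^esub> (z \<otimes>\<^bsub>A\<^esub> y)"
    and smult_mult_left: "\<lbrakk>c \<in> carrier F; x \<in> carrier A; y \<in> carrier A\<rbrakk> \<Longrightarrow>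
      (c \<odot>\<^bsub>A\<^esub> x) \<otimes>\<^bsub>A\<^esub> y = c \<odot>\<^bsub>A\<^esub> (x \<otimes>\<^bsub>A\<^esub> y)"
    and smult_mult_right: "\<lbrakk>c \<in> carrier F; x \<in> carrier A; y \<in> carrier A\<rbrakk> \<Longrightarrow>
      x \<otimes>\<^bsub>A\<^esub> (c \<odot>\<^bsub>A\<^esub> y) = c \<odot>\<^bsub>A\<^esub> (x \<otimes>\<^bsub>A\<^esub> y)"

definition nu_subalgebra ::
    "'b set \<Rightarrow> ('a, 'm) ring_scheme \<Rightarrow> ('a, 'b, 'n) module_scheme \<Rightarrow> bool" where
  "nu_subalgebra S F A \<longleftrightarrow>
     submodule S F A \<and> (\<forall>x \<in> S. \<forall>y \<in> S. x \<otimes>\<^bsub>A\<^esub> y \<in> S)"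

definition nu_ideal ::
    "'b set \<Rightarrow> ('a, 'm) ring_scheme \<Rightarrow> ('a, 'b, 'n) module_scheme \<Rightarrow> bool" where
  "nu_ideal I F A \<longleftrightarrow>
     submodule I F A \<and>
     (\<forall>x \<in> I. \<forall>r \<in> carrier A. r \<otimes>\<^bsub>A\<^esub> x \<in> I \<and> x \<otimes>\<^bsub>A\<^esub> r \<in> I)"

text \<open>
  A word is a list of variable indices (counted from 0), and a noncommutative polynomial is its
  coefficient function on words. The condition at the empty word excludes a constant term.
\<close>

definition monomials :: "('a, 'm) ring_scheme \<Rightarrow> (nat list \<Rightarrow> 'a) \<Rightarrow> nat list set" where
  "monomials F f = {w. f w \<noteq> \<zero>\<^bsub>F\<^esub>}"

definition free_nu_algebra :: "('a, 'm) ring_scheme \<Rightarrow> (nat list \<Rightarrow> 'a) set" where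
  "free_nu_algebra F = {f. range f \<subseteq> carrier F \<and> finite (monomials F f) \<and> f [] = \<zero>\<^bsub>F\<^esub>}"

text \<open>Used for nonzero polynomials only, so the sets below are finite and nonempty.\<close>

definition degree :: "('a, 'm) ring_scheme \<Rightarrow> (nat list \<Rightarrow> 'a) \<Rightarrow> nat" where
  "degree F f = Max (length ` monomials F f)"

definition low_degree :: "('a, 'm) ring_scheme \<Rightarrow> (nat list \<Rightarrow> 'a) \<Rightarrow> nat" where
  "low_degree F f = Min (length ` monomials F f)"

text \<open>The value at the empty word is arbitrary: that word is not a monomial of any polynomial.\<close>

fun word_eval :: "('a, 'b, 'n) module_scheme \<Rightarrow> (nat \<Rightarrow> 'b) \<Rightarrow> nat list \<Rightarrow> 'b" where
  "word_eval A s [] = \<zero>\<^bsub>A\<^esub>"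
| "word_eval A s [i] = s i"
| "word_eval A s (i # j # w) = s i \<otimes>\<^bsub>A\<^esub> word_eval A s (j # w)"

definition poly_eval ::
    "('a, 'm) ring_scheme \<Rightarrow> ('a, 'b, 'n) module_scheme \<Rightarrow>
     (nat \<Rightarrow> 'b) \<Rightarrow> (nat list \<Rightarrow> 'a) \<Rightarrow> 'b" where
  "poly_eval F A s f = (\<Oplus>\<^bsub>A\<^esub>w \<in> monomials F f. f w \<odot>\<^bsub>A\<^esub> word_eval A s w)"

text \<open>
  Values are assigned to all variables at once; only the finitely many that occur in
  \<open>f\<close> matter, and the carrier of an algebra is never empty.
\<close>

definition satisfies_identity ::
    "('a, 'm) ring_scheme \<Rightarrow> ('a, 'b, 'n) module_scheme \<Rightarrow> (nat list \<Rightarrow> 'a) \<Rightarrow> bool" where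
  "satisfies_identity F A f \<longleftrightarrow>
     f \<in> free_nu_algebra F \<and> f \<noteq> (\<lambda>_. \<zero>\<^bsub>F\<^esub>) \<and>
     (\<forall>s. range s \<subseteq> carrier A \<longrightarrow> poly_eval F A s f = \<zero>\<^bsub>A\<^esub>)"

end

theory Submission
  imports Defs
begin

text \<open>
  Let \<open>R\<close> be the algebra of strictly upper triangular matrices of size \<open>d\<^sub>1 d\<^sub>2\<close>, cut into blocks of
  size \<open>d\<^sub>1\<close>. The block diagonal matrices form a subalgebra \<open>R\<^sub>1\<close> with all products of \<open>d\<^sub>1\<close> factors
  equal to zero, and the strictly block upper triangular ones an ideal \<open>R\<^sub>2\<close> with all products of
  \<open>d\<^sub>2\<close> factors equal to zero, so every monomial of \<open>f\<^sub>i\<close> vanishes on \<open>R\<^sub>i\<close>.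
  Conversely, let \<open>g\<close> be a nonzero polynomial and \<open>u\<close> one of its monomials. If the matrix units
  at \<open>(p k, p (k + 1))\<close>, \<open>k < length u\<close>, all belong to the algebra for an injective \<open>p\<close>, then
  substituting for \<open>x\<^sub>i\<close> the sum of those with \<open>u ! k = i\<close> gives \<open>g\<close> a value whose entry at
  \<open>(p 0, p (length u))\<close> is the coefficient of \<open>u\<close>. In \<open>R\<close> and \<open>R\<^sub>1\<close> one takes \<open>p k = k\<close>, in \<open>R\<^sub>2\<close>
  one takes \<open>p k = d\<^sub>1 k\<close>.
\<close>

section \<open>Matrices supported on a relation\<close>

text \<open>A matrix is a function on words: its entry at \<open>(i, j)\<close> is the value at the word \<open>[i, j]\<close>.\<close>

definition incidence_carrier :: "('a, 'm) ring_scheme \<Rightarrow> (nat \<times> nat) set \<Rightarrow> (nat list \<Rightarrow> 'a) set" where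
  "incidence_carrier F r =
     {x. range x \<subseteq> carrier F \<and> (\<forall>w. x w \<noteq> \<zero>\<^bsub>F\<^esub> \<longrightarrow> (\<exists>(i, j) \<in> r. w = [i, j]))}"

text \<open>The middle index is cut off at \<open>n\<close> whatever the supports are, so every sum
  is finite and the laws below hold for arbitrary functions with values in the ring.\<close>

definition matrix_mult ::
    "('a, 'm) ring_scheme \<Rightarrow> nat \<Rightarrow> (nat list \<Rightarrow> 'a) \<Rightarrow> (nat list \<Rightarrow> 'a) \<Rightarrow> nat list \<Rightarrow> 'a" where
  "matrix_mult F n x y =
     (\<lambda>w. if length w = 2 then \<Oplus>\<^bsub>F\<^esub>k\<in>{..<n}. x [w ! 0, k] \<otimes>\<^bsub>F\<^esub> y [k, w ! 1] else \<zero>\<^bsub>F\<^esub>)"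

text \<open>Only the carrier depends on \<open>r\<close>, so subalgebras arise by shrinking the
  relation while all operations stay the same.\<close>

definition incidence_algebra ::
    "('a, 'm) ring_scheme \<Rightarrow> nat \<Rightarrow> (nat \<times> nat) set \<Rightarrow> ('a, nat list \<Rightarrow> 'a) module" where
  "incidence_algebra F n r =
     \<lparr>carrier = incidence_carrier F r, mult = matrix_mult F n, one = (\<lambda>_. \<zero>\<^bsub>F\<^esub>),
      zero = (\<lambda>_. \<zero>\<^bsub>F\<^esub>), add = (\<lambda>x y w. x w \<oplus>\<^bsub>F\<^esub> y w), smult = (\<lambda>c x w. c \<otimes>\<^bsub>F\<^esub> x w)\<rparr>"

lemma incidence_algebra_simps [simp]:
  "carrier (incidence_algebra F n r) = incidence_carrier F r"
  "x \<otimes>\<^bsub>incidence_algebra F n r\<^esub> y = matrix_mult F n x y"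
  "\<zero>\<^bsub>incidence_algebra F n r\<^esub> = (\<lambda>_. \<zero>\<^bsub>F\<^esub>)"
  "x \<oplus>\<^bsub>incidence_algebra F n r\<^esub> y = (\<lambda>w. x w \<oplus>\<^bsub>F\<^esub> y w)"
  "c \<odot>\<^bsub>incidence_algebra F n r\<^esub> x = (\<lambda>w. c \<otimes>\<^bsub>F\<^esub> x w)"
  by (simp_all add: incidence_algebra_def)

text \<open>Turns the restrictions of \<open>R\<close> to \<open>R\<^sub>1\<close> and
  \<open>R\<^sub>2\<close> into incidence algebras, so that the same lemmas on identities serve all
  three algebras.\<close>

lemma incidence_algebra_update_carrier:
  "incidence_algebra F n r\<lparr>carrier := incidence_carrier F q\<rparr> = incidence_algebra F n q"
  by (simp add: incidence_algebra_def)

lemma incidence_carrier_closed: "x \<in> incidence_carrier F r \<Longrightarrow> x w \<in> carrier F"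
  by (auto simp: incidence_carrier_def)

lemma incidence_carrier_support:
  "x \<in> incidence_carrier F r \<Longrightarrow> x w \<noteq> \<zero>\<^bsub>F\<^esub> \<Longrightarrow> \<exists>(i, j) \<in> r. w = [i, j]"
  by (auto simp: incidence_carrier_def)

lemma incidence_carrier_entry:
  "x \<in> incidence_carrier F r \<Longrightarrow> x [i, j] \<noteq> \<zero>\<^bsub>F\<^esub> \<Longrightarrow> (i, j) \<in> r"
  using incidence_carrier_support by fastforce

lemma incidence_carrier_mono: "r \<subseteq> q \<Longrightarrow> incidence_carrier F r \<subseteq> incidence_carrier F q"
  by (fastforce simp: incidence_carrier_def)

lemma incidence_carrierI:
  assumes "\<And>w. x w \<in> carrier F"
    and "\<And>w. x w \<noteq> \<zero>\<^bsub>F\<^esub> \<Longrightarrow> \<exists>(i, j) \<in> r. w = [i, j]"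
  shows "x \<in> incidence_carrier F r"
  using assms by (auto simp: incidence_carrier_def)

lemma matrix_mult_entry:
  "matrix_mult F n x y [i, j] = (\<Oplus>\<^bsub>F\<^esub>k\<in>{..<n}. x [i, k] \<otimes>\<^bsub>F\<^esub> y [k, j])"
  by (simp add: matrix_mult_def)

lemma length_two_cases:
  assumes "\<And>i j. w = [i, j] \<Longrightarrow> P" and "length w \<noteq> 2 \<Longrightarrow> P"
  shows P
  using assms by (metis (no_types, lifting) One_nat_def Suc_1 Suc_length_conv length_0_conv)

section \<open>Matrix multiplication and its laws\<close>

lemma (in abelian_monoid) finsum_swap:
  assumes "finite A" and "finite B" and "\<And>i j. i \<in> A \<Longrightarrow> j \<in> B \<Longrightarrow> f i j \<in> carrier G"
  shows "(\<Oplus>i\<in>A. \<Oplus>j\<in>B. f i j) = (\<Oplus>j\<in>B. \<Oplus>i\<in>A. f i j)"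
  using assms(1,3)
proof (induction A rule: finite_induct)
  case empty
  then show ?case by simp
next
  case (insert a A)
  have "(\<Oplus>j\<in>B. \<Oplus>i\<in>insert a A. f i j) = (\<Oplus>j\<in>B. f a j \<oplus> (\<Oplus>i\<in>A. f i j))"
    using insert by (intro finsum_cong') (auto intro!: finsum_closed)
  also have "\<dots> = (\<Oplus>j\<in>B. f a j) \<oplus> (\<Oplus>j\<in>B. \<Oplus>i\<in>A. f i j)"
    using insert by (intro finsum_addf) (auto intro!: finsum_closed)
  finally show ?case
    using insert by (simp add: Pi_def)
qed

lemma (in abelian_monoid) finsum_eq_zero: "(\<And>a. a \<in> A \<Longrightarrow> f a = \<zero>) \<Longrightarrow> finsum G f A = \<zero>"
  by (rule add.finprod_one_eqI)

lemma (in abelian_monoid) finsum_nonzero: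
  assumes "finsum G f A \<noteq> \<zero>"
  obtains a where "a \<in> A" "f a \<noteq> \<zero>"
  using assms finsum_eq_zero[of A f] that by metis

text \<open>A nonzero entry of a product needs a nonzero summand, hence a two-step path through the
  supports of the factors: supports compose like relations.\<close>

lemma (in ring) matrix_mult_nonzero:
  assumes x: "\<And>w. x w \<in> carrier R" and y: "\<And>w. y w \<in> carrier R"
    and "matrix_mult R n x y w \<noteq> \<zero>"
  obtains i k j where "w = [i, j]" "x [i, k] \<noteq> \<zero>" "y [k, j] \<noteq> \<zero>"
proof (cases rule: length_two_cases[of w])
  case (1 i j)
  then have "(\<Oplus>k\<in>{..<n}. x [i, k] \<otimes> y [k, j]) \<noteq> \<zero>"
    using assms(3) by (simp add: matrix_mult_entry)
  then obtain k where "x [i, k] \<otimes> y [k, j] \<noteq> \<zero>"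
    by (rule finsum_nonzero)
  then have "x [i, k] \<noteq> \<zero>" "y [k, j] \<noteq> \<zero>"
    using x y by auto
  with 1 that show ?thesis by blast
next
  case 2
  then show ?thesis using assms(3) by (simp add: matrix_mult_def)
qed

lemma (in ring) matrix_mult_carrier:
  assumes "\<And>w. x w \<in> carrier R" and "\<And>w. y w \<in> carrier R"
  shows "matrix_mult R n x y w \<in> carrier R"
  using assms by (auto simp: matrix_mult_def intro!: finsum_closed)

text \<open>With three separate relations this covers both closure of an algebra (all equal) and
  absorption by an ideal from either side.\<close>

lemma (in ring) matrix_mult_closed:
  assumes x: "x \<in> incidence_carrier R r" and y: "y \<in> incidence_carrier R q"
    and rq: "r O q \<subseteq> t"
  shows "matrix_mult R n x y \<in> incidence_carrier R t"
proof (rule incidence_carrierI)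
  note closed = incidence_carrier_closed[OF x] incidence_carrier_closed[OF y]
  show "matrix_mult R n x y w \<in> carrier R" for w
    by (rule matrix_mult_carrier[OF closed])
  fix w
  assume "matrix_mult R n x y w \<noteq> \<zero>"
  then obtain i k j where "w = [i, j]" "x [i, k] \<noteq> \<zero>" "y [k, j] \<noteq> \<zero>"
    by (rule matrix_mult_nonzero[OF closed])
  then show "\<exists>(i, j) \<in> t. w = [i, j]"
    using incidence_carrier_entry[OF x] incidence_carrier_entry[OF y] rq by blast
qed

lemma (in ring) matrix_mult_assoc:
  assumes x: "\<And>w. x w \<in> carrier R" and y: "\<And>w. y w \<in> carrier R" and z: "\<And>w. z w \<in> carrier R"
  shows "matrix_mult R n (matrix_mult R n x y) z = matrix_mult R n x (matrix_mult R n y z)"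
proof
  fix w
  show "matrix_mult R n (matrix_mult R n x y) z w = matrix_mult R n x (matrix_mult R n y z) w"
  proof (cases rule: length_two_cases[of w])
    case (1 i j)
    have "matrix_mult R n (matrix_mult R n x y) z w
        = (\<Oplus>k\<in>{..<n}. \<Oplus>l\<in>{..<n}. x [i, l] \<otimes> y [l, k] \<otimes> z [k, j])"
      unfolding 1 matrix_mult_entry
      using x y z by (intro finsum_cong' finsum_ldistr) (auto intro!: finsum_closed)
    also have "\<dots> = (\<Oplus>l\<in>{..<n}. \<Oplus>k\<in>{..<n}. x [i, l] \<otimes> y [l, k] \<otimes> z [k, j])"
      using x y z by (intro finsum_swap) auto
    also have "\<dots> = (\<Oplus>l\<in>{..<n}. \<Oplus>k\<in>{..<n}. x [i, l] \<otimes> (y [l, k] \<otimes> z [k, j]))"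
      using x y z by (simp add: m_assoc)
    also have "\<dots> = matrix_mult R n x (matrix_mult R n y z) w"
      unfolding 1 matrix_mult_entry
      using x y z by (intro finsum_cong' finsum_rdistr[symmetric]) (auto intro!: finsum_closed)
    finally show ?thesis .
  next
    case 2
    then show ?thesis by (simp add: matrix_mult_def)
  qed
qed

lemma (in ring) matrix_mult_add_left:
  assumes x: "\<And>w. x w \<in> carrier R" and y: "\<And>w. y w \<in> carrier R" and z: "\<And>w. z w \<in> carrier R"
  shows "matrix_mult R n (\<lambda>w. x w \<oplus> y w) z = (\<lambda>w. matrix_mult R n x z w \<oplus> matrix_mult R n y z w)"
  using assms by (auto simp: matrix_mult_def fun_eq_iff l_distr finsum_addf Pi_def)

lemma (in ring) matrix_mult_add_right:
  assumes x: "\<And>w. x w \<in> carrier R" and y: "\<And>w. y w \<in> carrier R" and z: "\<And>w. z w \<in> carrier R"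
  shows "matrix_mult R n z (\<lambda>w. x w \<oplus> y w) = (\<lambda>w. matrix_mult R n z x w \<oplus> matrix_mult R n z y w)"
  using assms by (auto simp: matrix_mult_def fun_eq_iff r_distr finsum_addf Pi_def)

lemma (in ring) matrix_mult_smult_left:
  assumes c: "c \<in> carrier R" and x: "\<And>w. x w \<in> carrier R" and y: "\<And>w. y w \<in> carrier R"
  shows "matrix_mult R n (\<lambda>w. c \<otimes> x w) y = (\<lambda>w. c \<otimes> matrix_mult R n x y w)"
  using assms by (auto simp: matrix_mult_def fun_eq_iff finsum_rdistr m_assoc Pi_def)

lemma (in cring) matrix_mult_smult_right:
  assumes c: "c \<in> carrier R" and x: "\<And>w. x w \<in> carrier R" and y: "\<And>w. y w \<in> carrier R"
  shows "matrix_mult R n x (\<lambda>w. c \<otimes> y w) = (\<lambda>w. c \<otimes> matrix_mult R n x y w)"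
  using assms by (auto simp: matrix_mult_def fun_eq_iff finsum_rdistr m_lcomm Pi_def)

section \<open>Algebras, subalgebras and ideals from relations\<close>

lemma (in ring) incidence_carrier_add:
  assumes "x \<in> incidence_carrier R r" and "y \<in> incidence_carrier R r"
  shows "(\<lambda>w. x w \<oplus> y w) \<in> incidence_carrier R r"
proof (rule incidence_carrierI)
  note [simp] = incidence_carrier_closed[OF assms(1)] incidence_carrier_closed[OF assms(2)]
  show "x w \<oplus> y w \<in> carrier R" for w by simp
  fix w
  assume "x w \<oplus> y w \<noteq> \<zero>"
  then have "x w \<noteq> \<zero> \<or> y w \<noteq> \<zero>" by auto
  then show "\<exists>(i, j) \<in> r. w = [i, j]"
    using assms incidence_carrier_support by metis
qed

lemma (in ring) incidence_carrier_smult: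
  assumes "c \<in> carrier R" and "x \<in> incidence_carrier R r"
  shows "(\<lambda>w. c \<otimes> x w) \<in> incidence_carrier R r"
proof (rule incidence_carrierI)
  note [simp] = incidence_carrier_closed[OF assms(2)]
  show "c \<otimes> x w \<in> carrier R" for w using assms(1) by simp
  fix w
  assume "c \<otimes> x w \<noteq> \<zero>"
  then have "x w \<noteq> \<zero>" using assms(1) by auto
  then show "\<exists>(i, j) \<in> r. w = [i, j]"
    using assms(2) incidence_carrier_support by metis
qed

lemma (in ring) incidence_carrier_zero: "(\<lambda>_. \<zero>) \<in> incidence_carrier R r"
  by (auto simp: incidence_carrier_def)

lemma (in ring) incidence_abelian_group: "abelian_group (incidence_algebra R n r)"
proof (rule abelian_groupI; simp add: incidence_carrier_add incidence_carrier_zero)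
  fix x
  assume x: "x \<in> incidence_carrier R r"
  show "(\<lambda>w. \<zero> \<oplus> x w) = x"
    using incidence_carrier_closed[OF x] by simp
  show "\<exists>y\<in>incidence_carrier R r. (\<lambda>w. y w \<oplus> x w) = (\<lambda>_. \<zero>)"
  proof
    \<comment> \<open>The negative is taken as the scalar multiple by minus one, so closure under
      scalars puts it in the carrier.\<close>
    show "(\<lambda>w. \<ominus> \<one> \<otimes> x w) \<in> incidence_carrier R r"
      using x by (intro incidence_carrier_smult) auto
    show "(\<lambda>w. \<ominus> \<one> \<otimes> x w \<oplus> x w) = (\<lambda>_. \<zero>)"
      using incidence_carrier_closed[OF x] by (simp add: l_minus l_neg)
  qed
qed (auto simp: incidence_carrier_closed a_ac fun_eq_iff)

text \<open>Transitivity enters through closure under multiplication only; the other laws come from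
  the field entry by entry or from the laws of matrix multiplication.\<close>

lemma (in field) incidence_nu_algebra:
  assumes "trans r"
  shows "nu_algebra R (incidence_algebra R n r)"
proof -
  note closed = incidence_carrier_closed[where F = R]
  have "module R (incidence_algebra R n r)"
    by (rule moduleI[OF is_cring incidence_abelian_group])
      (auto simp: incidence_carrier_smult closed l_distr r_distr m_assoc)
  moreover have "r O r \<subseteq> r"
    using assms by (auto dest: transD)
  ultimately show ?thesis
    by (intro nu_algebra.intro nu_algebra_axioms.intro field_axioms)
      (simp_all add: matrix_mult_closed closed matrix_mult_assoc matrix_mult_add_left
        matrix_mult_add_right matrix_mult_smult_left matrix_mult_smult_right)
qed

lemma (in field) incidence_nu_subalgebra:
  assumes "trans r" and "trans q" and "r \<subseteq> q"
  shows "nu_subalgebra (incidence_carrier R r) R (incidence_algebra R n q)"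
proof -
  interpret q: nu_algebra R "incidence_algebra R n q"
    by (rule incidence_nu_algebra[OF assms(2)])
  interpret r: nu_algebra R "incidence_algebra R n r"
    by (rule incidence_nu_algebra[OF assms(1)])
  have "submodule (incidence_carrier R r) R (incidence_algebra R n q)"
    using incidence_carrier_mono[OF assms(3)]
    by (intro q.module_incl_imp_submodule)
      (simp_all add: incidence_algebra_update_carrier r.module_axioms)
  then show ?thesis
    using r.mult_closed by (simp add: nu_subalgebra_def)
qed

lemma (in field) incidence_nu_ideal:
  assumes "trans r" and "trans q" and "r \<subseteq> q" and "q O r \<subseteq> r" and "r O q \<subseteq> r"
  shows "nu_ideal (incidence_carrier R r) R (incidence_algebra R n q)"
  using incidence_nu_subalgebra[OF assms(1-3)]
    matrix_mult_closed[OF _ _ assms(4)] matrix_mult_closed[OF _ _ assms(5)]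
  by (simp add: nu_ideal_def nu_subalgebra_def)

text \<open>A matrix is split by position: entries at positions in \<open>r\<close> form one
  summand, all others the second. Positions common to \<open>r\<close> and \<open>q\<close> go to
  the first, so the relations may overlap.\<close>

lemma (in ring) incidence_carrier_Un:
  "incidence_carrier R (r \<union> q)
   = incidence_carrier R r <+>\<^bsub>incidence_algebra R n (r \<union> q)\<^esub> incidence_carrier R q"
proof
  show "incidence_carrier R (r \<union> q)
      \<subseteq> incidence_carrier R r <+>\<^bsub>incidence_algebra R n (r \<union> q)\<^esub> incidence_carrier R q"
  proof
    fix x
    assume x: "x \<in> incidence_carrier R (r \<union> q)"
    note [simp] = incidence_carrier_closed[OF x]
    let ?E = "{w. \<exists>(i, j) \<in> r. w = [i, j]}"
    define y where "y w = (if w \<in> ?E then x w else \<zero>)" for w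
    define z where "z w = (if w \<in> ?E then \<zero> else x w)" for w
    have "y \<in> incidence_carrier R r"
      by (rule incidence_carrierI) (auto simp: y_def split: if_splits)
    moreover have "z \<in> incidence_carrier R q"
      using incidence_carrier_support[OF x]
      by (intro incidence_carrierI) (fastforce simp: z_def split: if_splits)+
    moreover have "x = (\<lambda>w. y w \<oplus> z w)"
      by (auto simp: y_def z_def)
    ultimately show "x \<in> incidence_carrier R r
        <+>\<^bsub>incidence_algebra R n (r \<union> q)\<^esub> incidence_carrier R q"
      by (auto simp: set_add_def')
  qed
next
  have "incidence_carrier R r \<subseteq> incidence_carrier R (r \<union> q)"
    "incidence_carrier R q \<subseteq> incidence_carrier R (r \<union> q)"
    by (auto intro!: incidence_carrier_mono)
  then show "incidence_carrier R r <+>\<^bsub>incidence_algebra R n (r \<union> q)\<^esub> incidence_carrier R q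
      \<subseteq> incidence_carrier R (r \<union> q)"
    by (auto simp: set_add_def' intro!: incidence_carrier_add)
qed

section \<open>Values of words, and low degree\<close>

text \<open>Zero must lie in \<open>C\<close> because it is the default value of the empty
  word.\<close>

lemma word_eval_in:
  assumes "range s \<subseteq> C" and "\<zero>\<^bsub>A\<^esub> \<in> C" and "\<And>x y. x \<in> C \<Longrightarrow> y \<in> C \<Longrightarrow> x \<otimes>\<^bsub>A\<^esub> y \<in> C"
  shows "word_eval A s v \<in> C"
proof (induction v)
  case (Cons a v)
  with assms show ?case by (cases v) auto
qed (simp add: assms(2))

lemma (in ring) incidence_word_eval_closed:
  assumes "trans r" and "range s \<subseteq> incidence_carrier R r"
  shows "word_eval (incidence_algebra R n r) s v \<in> incidence_carrier R r"
proof (rule word_eval_in[OF assms(2)])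
  have "r O r \<subseteq> r"
    using assms(1) by (auto dest: transD)
  then show "x \<otimes>\<^bsub>incidence_algebra R n r\<^esub> y \<in> incidence_carrier R r"
    if "x \<in> incidence_carrier R r" and "y \<in> incidence_carrier R r" for x y
    using that by (simp add: matrix_mult_closed)
qed (simp add: incidence_carrier_zero)

lemma finite_monomials: "f \<in> free_nu_algebra F \<Longrightarrow> finite (monomials F f)"
  by (simp add: free_nu_algebra_def)

lemma low_degree_le:
  assumes "f \<in> free_nu_algebra F" and "w \<in> monomials F f"
  shows "low_degree F f \<le> length w"
  using assms by (simp add: low_degree_def finite_monomials)

lemma low_degree_attained:
  assumes "f \<in> free_nu_algebra F" and "f \<noteq> (\<lambda>_. \<zero>\<^bsub>F\<^esub>)"
  obtains u where "u \<in> monomials F f" "length u = low_degree F f"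
proof -
  have "monomials F f \<noteq> {}"
    using assms(2) by (auto simp: monomials_def)
  then have "low_degree F f \<in> length ` monomials F f"
    unfolding low_degree_def using finite_monomials[OF assms(1)] by (intro Min_in) auto
  then show ?thesis using that by auto
qed

text \<open>Carries the bound on low degrees obtained for \<open>R\<close> over to the bound on
  degrees in claim (3).\<close>

lemma low_degree_le_degree:
  assumes "f \<in> free_nu_algebra F" and "f \<noteq> (\<lambda>_. \<zero>\<^bsub>F\<^esub>)"
  shows "low_degree F f \<le> degree F f"
proof -
  obtain u where "u \<in> monomials F f" "length u = low_degree F f"
    by (rule low_degree_attained[OF assms])
  then show ?thesis
    unfolding degree_def using finite_monomials[OF assms(1)]
    by (metis Max_ge finite_imageI imageI)
qed

section \<open>Vanishing of long words\<close>

text \<open>Each factor of a nonzero product moves along a pair of \<open>r\<close> and so raises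
  \<open>\<mu>\<close> by at least one.\<close>

lemma (in ring) word_eval_nonzero:
  assumes r: "trans r" and mu: "\<And>i j. (i, j) \<in> r \<Longrightarrow> \<mu> i < (\<mu> j :: nat)"
    and s: "range s \<subseteq> incidence_carrier R r"
    and "v \<noteq> []" and "word_eval (incidence_algebra R n r) s v [i, j] \<noteq> \<zero>"
  shows "\<mu> i + length v \<le> \<mu> j"
  using assms(4,5)
proof (induction v arbitrary: i)
  case (Cons a v)
  let ?A = "incidence_algebra R n r"
  have sa: "s a \<in> incidence_carrier R r" using s by auto
  show ?case
  proof (cases "v = []")
    case True
    with Cons.prems have "s a [i, j] \<noteq> \<zero>" by simp
    with True incidence_carrier_entry[OF sa] mu show ?thesis by fastforce
  next
    case False
    have "word_eval ?A s (a # v) = matrix_mult R n (s a) (word_eval ?A s v)"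
      using False by (cases v) auto
    moreover have "word_eval ?A s v \<in> incidence_carrier R r"
      by (rule incidence_word_eval_closed[OF r s])
    ultimately obtain k where "s a [i, k] \<noteq> \<zero>" and k: "word_eval ?A s v [k, j] \<noteq> \<zero>"
      using Cons.prems(2) sa
      by (auto elim!: matrix_mult_nonzero[rotated 2] intro: incidence_carrier_closed)
    then have "\<mu> i < \<mu> k"
      using incidence_carrier_entry[OF sa] mu by blast
    with Cons.IH[OF False k] show ?thesis by simp
  qed
qed simp

text \<open>The height function \<open>\<mu>\<close> bounds the lengths of chains in \<open>r\<close> below \<open>d\<close>.\<close>

lemma (in field) incidence_satisfies_identity:
  assumes r: "trans r" and mu: "\<And>i j. (i, j) \<in> r \<Longrightarrow> \<mu> i < (\<mu> j :: nat) \<and> \<mu> j < d"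
    and f: "f \<in> free_nu_algebra R" "f \<noteq> (\<lambda>_. \<zero>)" and d: "low_degree R f = d"
  shows "satisfies_identity R (incidence_algebra R n r) f"
proof -
  let ?A = "incidence_algebra R n r"
  have "poly_eval R ?A s f = \<zero>\<^bsub>?A\<^esub>" if s: "range s \<subseteq> carrier ?A" for s
  proof -
    have "word_eval ?A s v = (\<lambda>_. \<zero>)" if v: "v \<in> monomials R f" for v
    proof (rule ccontr)
      assume "word_eval ?A s v \<noteq> (\<lambda>_. \<zero>)"
      then obtain w where w: "word_eval ?A s v w \<noteq> \<zero>" by auto
      have "word_eval ?A s v \<in> incidence_carrier R r"
        using incidence_word_eval_closed[OF r] s by simp
      then obtain i j where ij: "(i, j) \<in> r" "w = [i, j]"
        using incidence_carrier_support w by fast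
      have "v \<noteq> []" using w by auto
      then have "\<mu> i + length v \<le> \<mu> j"
        using word_eval_nonzero[OF r, of \<mu> s v n i j] mu s w ij by auto
      moreover have "d \<le> length v"
        using low_degree_le[OF f(1) v] d by simp
      ultimately show False using mu[OF ij(1)] by simp
    qed
    moreover have "f v \<in> carrier R" for v
      using f(1) by (auto simp: free_nu_algebra_def)
    ultimately show ?thesis
      unfolding poly_eval_def
      by (intro abelian_monoid.finsum_eq_zero[OF abelian_group.axioms(1)[OF incidence_abelian_group]])
        simp
  qed
  then show ?thesis using f by (simp add: satisfies_identity_def)
qed

section \<open>Recovering a coefficient by substitution along a path\<close>

lemma (in ring) incidence_finsum_apply:
  assumes "finite S" and "\<And>a. a \<in> S \<Longrightarrow> h a \<in> incidence_carrier R r"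
  shows "finsum (incidence_algebra R n r) h S w = (\<Oplus>a\<in>S. h a w)"
proof -
  interpret A: abelian_group "incidence_algebra R n r"
    by (rule incidence_abelian_group)
  have "h a w \<in> carrier R" if "a \<in> S" for a
    using assms(2)[OF that] by (rule incidence_carrier_closed)
  with assms show ?thesis
    by (induction S rule: finite_induct) (auto simp: Pi_def)
qed

text \<open>
  For one-letter words \<open>v\<close> these are the matrices substituted for the variables; for longer \<open>v\<close>
  they are the resulting values of \<open>v\<close>, with an entry for each occurrence of \<open>v\<close> in \<open>u\<close>.
\<close>

definition path_matrices ::
    "('a, 'm) ring_scheme \<Rightarrow> (nat \<Rightarrow> nat) \<Rightarrow> nat list \<Rightarrow> nat list \<Rightarrow> nat list \<Rightarrow> 'a" where
  "path_matrices F p u v =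
     (\<lambda>w. if \<exists>k. k + length v \<le> length u \<and> take (length v) (drop k u) = v \<and>
               w = [p k, p (k + length v)]
          then \<one>\<^bsub>F\<^esub> else \<zero>\<^bsub>F\<^esub>)"

text \<open>As \<open>p\<close> is injective, a letter ending at \<open>p (Suc k)\<close> can only
  be followed by an occurrence of \<open>v\<close> starting at position \<open>Suc k\<close>. So
  each entry of the product has at most one nonzero summand, and that summand is
  \<open>\<one>\<close>, whatever the characteristic.\<close>

lemma (in ring) path_matrices_Cons:
  assumes p: "inj p" and n: "\<And>k. k < length u \<Longrightarrow> p (Suc k) < n"
  shows "matrix_mult R n (path_matrices R p u [a]) (path_matrices R p u v)
         = path_matrices R p u (a # v)"
proof
  fix w
  \<comment> \<open>An occurrence of \<open>a # v\<close> at \<open>k\<close> is an occurrence of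
    \<open>a\<close> at \<open>k\<close> followed by one of \<open>v\<close> at
    \<open>Suc k\<close>.\<close>
  have take_Cons: "take (Suc (length v)) (drop k u) = a # v \<longleftrightarrow>
      take 1 (drop k u) = [a] \<and> take (length v) (drop (Suc k) u) = v" if "k < length u" for k
    using that by (simp flip: Cons_nth_drop_Suc)
  show "matrix_mult R n (path_matrices R p u [a]) (path_matrices R p u v) w
      = path_matrices R p u (a # v) w"
  proof (cases "\<exists>k. k + length (a # v) \<le> length u \<and> take (length (a # v)) (drop k u) = a # v \<and>
      w = [p k, p (k + length (a # v))]")
    case True
    then obtain k where k: "k + Suc (length v) \<le> length u"
        "take 1 (drop k u) = [a]" "take (length v) (drop (Suc k) u) = v"
      and w: "w = [p k, p (Suc k + length v)]"
      using take_Cons by auto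
    have left: "path_matrices R p u [a] [p k, m] = (if p (Suc k) = m then \<one> else \<zero>)" for m
      using k p by (auto simp: path_matrices_def inj_eq)
    have right: "path_matrices R p u v [p (Suc k), p (Suc k + length v)] = \<one>"
      using k unfolding path_matrices_def by (auto intro!: exI[of _ "Suc k"])
    have closed: "path_matrices R p u v w \<in> carrier R" for w
      by (simp add: path_matrices_def)
    have "matrix_mult R n (path_matrices R p u [a]) (path_matrices R p u v) w
        = (\<Oplus>m\<in>{..<n}. if p (Suc k) = m then path_matrices R p u v [m, p (Suc k + length v)] else \<zero>)"
      unfolding w matrix_mult_entry left
      by (rule finsum_cong') (auto simp: closed)
    \<comment> \<open>The only contributing index \<open>p (Suc k)\<close> lies in the range of
      summation by assumption \<open>n\<close>.\<close>
    also have "\<dots> = path_matrices R p u v [p (Suc k), p (Suc k + length v)]"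
      using n[of k] k(1) closed by (intro add.finprod_singleton[simplified]) auto
    finally show ?thesis
      using True right by (simp add: path_matrices_def)
  next
    case False
    have "matrix_mult R n (path_matrices R p u [a]) (path_matrices R p u v) w = \<zero>"
    proof (rule ccontr)
      assume *: "\<not> ?thesis"
      obtain i m j where w: "w = [i, j]" and "path_matrices R p u [a] [i, m] \<noteq> \<zero>"
        "path_matrices R p u v [m, j] \<noteq> \<zero>"
        by (rule matrix_mult_nonzero[OF _ _ *]) (auto simp: path_matrices_def)
      then have "\<exists>k. k < length u \<and> take 1 (drop k u) = [a] \<and> i = p k \<and> m = p (Suc k)"
        and "\<exists>l. l + length v \<le> length u \<and> take (length v) (drop l u) = v \<and>
          m = p l \<and> j = p (l + length v)"
        by (auto simp: path_matrices_def Suc_le_eq split: if_splits)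
      then obtain k l where k: "k < length u" "take 1 (drop k u) = [a]" "i = p k" "m = p (Suc k)"
        and l: "l + length v \<le> length u" "take (length v) (drop l u) = v"
          "m = p l" "j = p (l + length v)"
        by blast
      have "l = Suc k" using k l p by (auto simp: inj_eq)
      then show False
        using False k l w take_Cons[of k] by auto
    qed
    moreover have "path_matrices R p u (a # v) w = \<zero>"
      unfolding path_matrices_def by (rule if_not_P[OF False])
    ultimately show ?thesis by simp
  qed
qed

text \<open>The empty word is excluded: it evaluates to zero, whereas \<open>path_matrices\<close>
  gives it diagonal entries \<open>\<one>\<close>.\<close>

lemma (in ring) word_eval_path_matrices:
  assumes "inj p" and "\<And>k. k < length u \<Longrightarrow> p (Suc k) < n" and "v \<noteq> []"
  shows "word_eval (incidence_algebra R n r) (\<lambda>i. path_matrices R p u [i]) v = path_matrices R p u v"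
  using assms(3)
proof (induction v)
  case (Cons a v)
  then show ?case
    using path_matrices_Cons[OF assms(1,2)] by (cases v) auto
qed simp

text \<open>Taking for \<open>u\<close> a shortest monomial makes a path of
  \<open>low_degree R g\<close> steps in \<open>r\<close> suffice, however long the other monomials
  are.\<close>

lemma (in field) incidence_not_identity:
  assumes r: "trans r" and p: "inj p" and n: "\<And>i j. (i, j) \<in> r \<Longrightarrow> j < n"
    and path: "\<And>k. k < low_degree R g \<Longrightarrow> (p k, p (Suc k)) \<in> r"
  shows "\<not> satisfies_identity R (incidence_algebra R n r) g"
proof
  let ?A = "incidence_algebra R n r"
  assume "satisfies_identity R ?A g"
  then have g: "g \<in> free_nu_algebra R" "g \<noteq> (\<lambda>_. \<zero>)"
    and vanish: "\<And>s. range s \<subseteq> incidence_carrier R r \<Longrightarrow> poly_eval R ?A s g = (\<lambda>_. \<zero>)"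
    by (auto simp: satisfies_identity_def)
  obtain u where u: "u \<in> monomials R g" "length u = low_degree R g"
    by (rule low_degree_attained[OF g])
  have g_closed: "g v \<in> carrier R" for v
    using g(1) by (auto simp: free_nu_algebra_def)
  have nonempty: "v \<noteq> []" if "v \<in> monomials R g" for v
    using that g(1) by (auto simp: free_nu_algebra_def monomials_def)
  define s where "s i = path_matrices R p u [i]" for i
  have "s i \<in> incidence_carrier R r" for i
  proof (rule incidence_carrierI)
    show "s i w \<in> carrier R" for w
      by (simp add: s_def path_matrices_def)
    fix w
    assume "s i w \<noteq> \<zero>"
    then obtain k where "Suc k \<le> length u" "w = [p k, p (Suc k)]"
      by (auto simp: s_def path_matrices_def split: if_splits)
    then show "\<exists>(i, j) \<in> r. w = [i, j]"
      using path[of k] u(2) by auto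
  qed
  then have s: "range s \<subseteq> incidence_carrier R r" by auto
  have eval: "word_eval ?A s v = path_matrices R p u v" if "v \<in> monomials R g" for v
    unfolding s_def
  proof (rule word_eval_path_matrices[OF p _ nonempty[OF that]])
    show "p (Suc k) < n" if "k < length u" for k
      using that path[of k] n u(2) by simp
  qed
  \<comment> \<open>An occurrence of \<open>v\<close> in \<open>u\<close> from \<open>p 0\<close> to
    \<open>p (length u)\<close> starts at 0 and has full length, by injectivity, so it is
    \<open>u\<close> itself. Hence this entry isolates the coefficient of \<open>u\<close>.\<close>
  have entry: "path_matrices R p u v [p 0, p (length u)] = (if u = v then \<one> else \<zero>)" for v
    using p by (auto simp: path_matrices_def inj_eq)
  have "\<zero> = poly_eval R ?A s g [p 0, p (length u)]"
    using vanish[OF s] by simp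
  also have "\<dots> = (\<Oplus>v\<in>monomials R g. g v \<otimes> word_eval ?A s v [p 0, p (length u)])"
    unfolding poly_eval_def
    using incidence_word_eval_closed[OF r s] g_closed
    by (subst incidence_finsum_apply[OF finite_monomials[OF g(1)], of _ r])
      (simp_all add: incidence_carrier_smult)
  also have "\<dots> = (\<Oplus>v\<in>monomials R g. if u = v then g v else \<zero>)"
    by (rule finsum_cong') (auto simp: eval entry g_closed)
  also have "\<dots> = g u"
    using u(1) g_closed finite_monomials[OF g(1)] by (intro add.finprod_singleton[simplified]) auto
  finally show False
    using u(1) by (simp add: monomials_def)
qed

section \<open>The block decomposition of strictly upper triangular matrices\<close>

theorem theorem3p2:
  fixes F :: "('k, 'm) ring_scheme"
    and f\<^sub>1 f\<^sub>2 :: "nat list \<Rightarrow> 'k"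
    and d\<^sub>1 d\<^sub>2 :: nat
  assumes "field F"
    and "f\<^sub>1 \<in> free_nu_algebra F" and "f\<^sub>1 \<noteq> (\<lambda>_. \<zero>\<^bsub>F\<^esub>)"
    and "f\<^sub>2 \<in> free_nu_algebra F" and "f\<^sub>2 \<noteq> (\<lambda>_. \<zero>\<^bsub>F\<^esub>)"
    and "low_degree F f\<^sub>1 = d\<^sub>1" and "d\<^sub>1 > 0"
    and "low_degree F f\<^sub>2 = d\<^sub>2" and "d\<^sub>2 > 0"
  shows "\<exists>(R :: ('k, nat list \<Rightarrow> 'k) module) R\<^sub>1 R\<^sub>2.
      nu_algebra F R \<and>
      nu_subalgebra R\<^sub>1 F R \<and> nu_subalgebra R\<^sub>2 F R \<and>
      carrier R = R\<^sub>1 <+>\<^bsub>R\<^esub> R\<^sub>2 \<and>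
      (satisfies_identity F (R\<lparr>carrier := R\<^sub>1\<rparr>) f\<^sub>1 \<and>
       \<not> (\<exists>g. satisfies_identity F (R\<lparr>carrier := R\<^sub>1\<rparr>) g \<and> low_degree F g < d\<^sub>1)) \<and>
      (satisfies_identity F (R\<lparr>carrier := R\<^sub>2\<rparr>) f\<^sub>2 \<and>
       \<not> (\<exists>g. satisfies_identity F (R\<lparr>carrier := R\<^sub>2\<rparr>) g \<and> low_degree F g < d\<^sub>2)) \<and>
      nu_ideal R\<^sub>2 F R \<and>
      \<not> (\<exists>g. satisfies_identity F R g \<and> degree F g < d\<^sub>1 * d\<^sub>2)"
proof -
  interpret field F by fact
  let ?n = "d\<^sub>1 * d\<^sub>2"
  \<comment> \<open>Indices run from 0; \<open>i div d\<^sub>1\<close> is the block of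
    \<open>i\<close>, and \<open>i mod d\<^sub>1\<close> its place within the block.\<close>
  define r\<^sub>1 where "r\<^sub>1 = {(i, j). i < j \<and> j < ?n \<and> i div d\<^sub>1 = j div d\<^sub>1}"
  define r\<^sub>2 where "r\<^sub>2 = {(i, j). i < j \<and> j < ?n \<and> i div d\<^sub>1 < j div d\<^sub>1}"
  define q where "q = r\<^sub>1 \<union> r\<^sub>2"
  have q: "q = {(i, j). i < j \<and> j < ?n}"
  proof -
    have "i div d\<^sub>1 = j div d\<^sub>1 \<or> i div d\<^sub>1 < j div d\<^sub>1" if "i < j" for i j
      using div_le_mono[of i j d\<^sub>1] that by linarith
    then show ?thesis by (auto simp: q_def r\<^sub>1_def r\<^sub>2_def)
  qed
  have trans: "trans r\<^sub>1" "trans r\<^sub>2" "trans q"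
    by (auto simp: r\<^sub>1_def r\<^sub>2_def q intro!: transI)
  have sub: "r\<^sub>1 \<subseteq> q" "r\<^sub>2 \<subseteq> q"
    by (auto simp: q_def)
  \<comment> \<open>A step in \<open>q\<close> never lowers the block number and a step in
    \<open>r\<^sub>2\<close> raises it, so their composite raises it in either order.\<close>
  have absorb: "q O r\<^sub>2 \<subseteq> r\<^sub>2" "r\<^sub>2 O q \<subseteq> r\<^sub>2"
  proof -
    have mono: "i div d\<^sub>1 \<le> j div d\<^sub>1" if "i < j" for i j
      using div_le_mono[of i j d\<^sub>1] that by simp
    have "(i, k) \<in> r\<^sub>2" if "(i, j) \<in> q" "(j, k) \<in> r\<^sub>2" for i j k
      using that mono[of i j] by (simp add: q r\<^sub>2_def)
    moreover have "(i, k) \<in> r\<^sub>2" if "(i, j) \<in> r\<^sub>2" "(j, k) \<in> q" for i j k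
      using that mono[of j k] by (simp add: q r\<^sub>2_def)
    ultimately show "q O r\<^sub>2 \<subseteq> r\<^sub>2" "r\<^sub>2 O q \<subseteq> r\<^sub>2"
      by blast+
  qed
  have bound: "j < ?n" if "(i, j) \<in> q" for i j
    using that by (simp add: q)
  let ?R = "incidence_algebra F ?n q"
  have id1: "satisfies_identity F (incidence_algebra F ?n r\<^sub>1) f\<^sub>1"
  \<comment> \<open>Inside one block the height is the place within the block, which takes only
    \<open>d\<^sub>1\<close> values.\<close>
  proof (rule incidence_satisfies_identity[OF trans(1), where \<mu> = "\<lambda>i. i mod d\<^sub>1"])
    fix i j
    assume ij: "(i, j) \<in> r\<^sub>1"
    then have "i div d\<^sub>1 * d\<^sub>1 = j div d\<^sub>1 * d\<^sub>1" and "i < j"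
      by (auto simp: r\<^sub>1_def)
    then have "i mod d\<^sub>1 < j mod d\<^sub>1"
      using div_mult_mod_eq[of i d\<^sub>1] div_mult_mod_eq[of j d\<^sub>1] by linarith
    then show "i mod d\<^sub>1 < j mod d\<^sub>1 \<and> j mod d\<^sub>1 < d\<^sub>1"
      using \<open>d\<^sub>1 > 0\<close> by simp
  qed fact+
  have id2: "satisfies_identity F (incidence_algebra F ?n r\<^sub>2) f\<^sub>2"
  \<comment> \<open>Here the height is the block number, and there are \<open>d\<^sub>2\<close>
    blocks.\<close>
  proof (rule incidence_satisfies_identity[OF trans(2), where \<mu> = "\<lambda>i. i div d\<^sub>1"])
    show "i div d\<^sub>1 < j div d\<^sub>1 \<and> j div d\<^sub>1 < d\<^sub>2" if "(i, j) \<in> r\<^sub>2" for i j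
      using that by (auto simp: r\<^sub>2_def less_mult_imp_div_less mult.commute)
  qed fact+
  have no1: "\<not> satisfies_identity F (incidence_algebra F ?n r\<^sub>1) g" if "low_degree F g < d\<^sub>1" for g
  proof (rule incidence_not_identity[OF trans(1), where p = id])
    show "(id k, id (Suc k)) \<in> r\<^sub>1" if "k < low_degree F g" for k
    proof -
      \<comment> \<open>The path 0, 1, 2, ... stays in the first block: a block of
        \<open>d\<^sub>1\<close> indices admits \<open>d\<^sub>1 - 1\<close> steps, just enough for
        a low degree below \<open>d\<^sub>1\<close>.\<close>
      have k: "Suc k < d\<^sub>1" using that \<open>low_degree F g < d\<^sub>1\<close> by simp
      also have "d\<^sub>1 \<le> ?n" using \<open>d\<^sub>2 > 0\<close> by simp
      finally show ?thesis using k by (simp add: r\<^sub>1_def)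
    qed
  qed (use bound sub in auto)
  have no2: "\<not> satisfies_identity F (incidence_algebra F ?n r\<^sub>2) g" if "low_degree F g < d\<^sub>2" for g
  \<comment> \<open>The path visits the first index of each block in turn, so every step enters a
    new block.\<close>
  proof (rule incidence_not_identity[OF trans(2), where p = "(*) d\<^sub>1"])
    show "inj ((*) d\<^sub>1)" using \<open>d\<^sub>1 > 0\<close> by (simp add: inj_def)
    show "(d\<^sub>1 * k, d\<^sub>1 * Suc k) \<in> r\<^sub>2" if "k < low_degree F g" for k
    proof -
      have "Suc k < d\<^sub>2" using that \<open>low_degree F g < d\<^sub>2\<close> by simp
      then have "d\<^sub>1 * Suc k < ?n"
        using \<open>d\<^sub>1 > 0\<close> by (simp only: mult_less_cancel1)
      moreover have "d\<^sub>1 * k < d\<^sub>1 * Suc k"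
        using \<open>d\<^sub>1 > 0\<close> by simp
      moreover have "d\<^sub>1 * k div d\<^sub>1 < d\<^sub>1 * Suc k div d\<^sub>1"
        using \<open>d\<^sub>1 > 0\<close> by (simp del: mult_Suc_right)
      ultimately show ?thesis by (simp only: r\<^sub>2_def mem_Collect_eq case_prod_conv simp_thms)
    qed
  qed (use bound sub in auto)
  have no: "\<not> satisfies_identity F ?R g" if "degree F g < ?n" for g
  proof
    assume *: "satisfies_identity F ?R g"
    then have "low_degree F g < ?n"
      using that low_degree_le_degree[of g F] by (auto simp: satisfies_identity_def)
    \<comment> \<open>All indices in their natural order form a path in \<open>q\<close> with
      \<open>d\<^sub>1 * d\<^sub>2 - 1\<close> steps.\<close>
    then have "\<not> satisfies_identity F ?R g"
      by (intro incidence_not_identity[OF trans(3), where p = id]) (auto simp: q)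
    with * show False by simp
  qed
  have "carrier ?R = incidence_carrier F r\<^sub>1 <+>\<^bsub>?R\<^esub> incidence_carrier F r\<^sub>2"
    using incidence_carrier_Un[of r\<^sub>1 r\<^sub>2 ?n] by (simp add: q_def)
  then show ?thesis
    using incidence_nu_algebra[OF trans(3)] incidence_nu_subalgebra[OF trans(1,3) sub(1)]
      incidence_nu_subalgebra[OF trans(2,3) sub(2)] id1 id2 no1 no2 no
      incidence_nu_ideal[OF trans(2,3) sub(2) absorb]
    by (intro exI[of _ ?R] exI[of _ "incidence_carrier F r\<^sub>1"] exI[of _ "incidence_carrier F r\<^sub>2"])
      (simp add: incidence_algebra_update_carrier del: incidence_algebra_simps, blast)
qed

end
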